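(* Let $X$ be an implicative-orthomodular lattice, and let $x,y\in X$. Then $x\to(x^*\Cap y^* )=x^*$ if and only if $y\to(y^*\Cap x^* )=y^*$.
   Context: A BE algebra is an algebra $(X,\to,1)$ of type $(2,0)$ such that for all $x,y,z\in X$: $x\to x=1$; $x\to 1=1$; $1\to x=x$; $x\to(y\to z)=y\to(x\to z)$. Write $x\le y$ iff $x\to y=1$. It is bounded if there is $0\in X$ with $0\le x$ for all $x\in X$; then $x^*:=x\to 0$. A bounded BE algebra is involutive if $x^{**}=x$ for all $x$. A BE algebra is implicative if $(x\to y)\to x=x$ for all $x,y$. In an involutive BE algebra put $x\Cap y:=((x^*\to y^* )\to y^* )^*$. An implicative-orthomodular lattice is an implicative involutive BE algebra satisfying $x\Cap(y\to x)=x$ for all $x,y$. *)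

theory Defs
  imports "HOL-Algebra.Congruence"
begin

record 'a be_struct = "'a partial_object" +
  imp :: "'a \<Rightarrow> 'a \<Rightarrow> 'a"  (infixr \<open>\<leadsto>\<index>\<close> 65)
  top_elem :: 'a  (\<open>\<one>\<index>\<close>)

definition be_le :: "('a, 'm) be_struct_scheme \<Rightarrow> 'a \<Rightarrow> 'a \<Rightarrow> bool"  (infix \<open>\<preceq>\<index>\<close> 50)
  where "x \<preceq>\<^bsub>X\<^esub> y \<longleftrightarrow> x \<leadsto>\<^bsub>X\<^esub> y = \<one>\<^bsub>X\<^esub>"

locale be_algebra =
  fixes X (structure)
  assumes imp_closed: "\<lbrakk>x \<in> carrier X; y \<in> carrier X\<rbrakk> \<Longrightarrow> x \<leadsto> y \<in> carrier X"
    and one_closed: "\<one> \<in> carrier X"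
    and imp_refl: "x \<in> carrier X \<Longrightarrow> x \<leadsto> x = \<one>"
    and imp_one: "x \<in> carrier X \<Longrightarrow> x \<leadsto> \<one> = \<one>"
    and one_imp: "x \<in> carrier X \<Longrightarrow> \<one> \<leadsto> x = x"
    and exchange: "\<lbrakk>x \<in> carrier X; y \<in> carrier X; z \<in> carrier X\<rbrakk> \<Longrightarrow>
      x \<leadsto> (y \<leadsto> z) = y \<leadsto> (x \<leadsto> z)"

(* The operation \<^sup>\<star> depends on the bottom element, so the bottom element is part of
   the structure. Being a least element for the relation \<preceq>, which is not assumed
   antisymmetric, does not determine it in a general BE algebra. *)
record 'a bounded_be_struct = "'a be_struct" +
  bot_elem :: 'a  (\<open>\<zero>\<index>\<close>)

locale bounded_be_algebra = be_algebra X for X (structure) +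
  assumes zero_closed: "\<zero> \<in> carrier X"
    and zero_le: "x \<in> carrier X \<Longrightarrow> \<zero> \<preceq> x"

definition be_neg :: "('a, 'm) bounded_be_struct_scheme \<Rightarrow> 'a \<Rightarrow> 'a"  (\<open>_\<^sup>\<star>\<index>\<close> [1000] 999)
  where "x\<^sup>\<star>\<^bsub>X\<^esub> = x \<leadsto>\<^bsub>X\<^esub> \<zero>\<^bsub>X\<^esub>"

definition be_Cap :: "('a, 'm) bounded_be_struct_scheme \<Rightarrow> 'a \<Rightarrow> 'a \<Rightarrow> 'a"  (infixl \<open>\<^bold>\<inter>\<index>\<close> 70)
  where "x \<^bold>\<inter>\<^bsub>X\<^esub> y = ((x\<^sup>\<star>\<^bsub>X\<^esub> \<leadsto>\<^bsub>X\<^esub> y\<^sup>\<star>\<^bsub>X\<^esub>) \<leadsto>\<^bsub>X\<^esub> y\<^sup>\<star>\<^bsub>X\<^esub>)\<^sup>\<star>\<^bsub>X\<^esub>"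

locale involutive_be_algebra = bounded_be_algebra X for X (structure) +
  assumes involutive: "x \<in> carrier X \<Longrightarrow> (x\<^sup>\<star>)\<^sup>\<star> = x"

locale implicative_be_algebra = be_algebra X for X (structure) +
  assumes implicative: "\<lbrakk>x \<in> carrier X; y \<in> carrier X\<rbrakk> \<Longrightarrow> (x \<leadsto> y) \<leadsto> x = x"

locale implicative_orthomodular_lattice =
  involutive_be_algebra X + implicative_be_algebra X for X (structure) +
  assumes orthomodular: "\<lbrakk>x \<in> carrier X; y \<in> carrier X\<rbrakk> \<Longrightarrow> x \<^bold>\<inter> (y \<leadsto> x) = x"

end

(* With x \<squnion> y = x' \<rightarrow> y as join and ' as orthocomplement, X is an orthomodular lattice, and
   x' \<Cap> y' is the Sasaki projection (x' \<squnion> y) \<sqinter> y'. The left-hand condition says that this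
   projection of a = x' to b = y' lies below a, i.e. that it equals a \<sqinter> b, which means that b
   commutes with a: b = (a \<sqinter> b) \<squnion> (a' \<sqinter> b). Then b \<squnion> a' = (a \<sqinter> b) \<squnion> a', and the
   orthomodular law turns a \<sqinter> (b \<squnion> a') into a \<sqinter> b, so a commutes with b. *)

theory Submission
  imports Defs
begin

context implicative_orthomodular_lattice
begin

definition join :: "'a \<Rightarrow> 'a \<Rightarrow> 'a"  (infixl \<open>\<squnion>\<close> 66)
  where "x \<squnion> y = x\<^sup>\<star> \<leadsto> y"

lemma neg_closed [simp]: "x \<in> carrier X \<Longrightarrow> x\<^sup>\<star> \<in> carrier X"
  by (simp add: be_neg_def imp_closed zero_closed)

lemma join_closed [simp]: "\<lbrakk>x \<in> carrier X; y \<in> carrier X\<rbrakk> \<Longrightarrow> x \<squnion> y \<in> carrier X"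
  by (simp add: join_def imp_closed)

lemma imp_eq_join: "x \<in> carrier X \<Longrightarrow> x \<leadsto> y = x\<^sup>\<star> \<squnion> y"
  by (simp add: join_def involutive)

lemma Cap_eq_join:
  assumes "x \<in> carrier X" "y \<in> carrier X"
  shows "x \<^bold>\<inter> y = ((x \<squnion> y\<^sup>\<star>)\<^sup>\<star> \<squnion> y\<^sup>\<star>)\<^sup>\<star>"
  using assms by (simp add: be_Cap_def imp_eq_join involutive)

text \<open>Exchange with \<open>\<zero>\<close> as the final conclusion swaps the two premises;
  involutivity removes the double complements left over.\<close>

lemma join_commute:
  assumes "x \<in> carrier X" "y \<in> carrier X"
  shows "x \<squnion> y = y \<squnion> x"
proof -
  have "x\<^sup>\<star> \<leadsto> (y\<^sup>\<star>)\<^sup>\<star> = y\<^sup>\<star> \<leadsto> (x\<^sup>\<star>)\<^sup>\<star>"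
    using exchange [of "x\<^sup>\<star>" "y\<^sup>\<star>" \<zero>] assms zero_closed
    by (simp add: be_neg_def [of X "x\<^sup>\<star>"] be_neg_def [of X "y\<^sup>\<star>"])
  then show ?thesis
    using assms by (simp add: join_def involutive)
qed

lemma join_left_commute:
  "\<lbrakk>x \<in> carrier X; y \<in> carrier X; z \<in> carrier X\<rbrakk> \<Longrightarrow> x \<squnion> (y \<squnion> z) = y \<squnion> (x \<squnion> z)"
  by (simp add: join_def exchange)

lemma join_assoc:
  "\<lbrakk>x \<in> carrier X; y \<in> carrier X; z \<in> carrier X\<rbrakk> \<Longrightarrow> x \<squnion> y \<squnion> z = x \<squnion> (y \<squnion> z)"
  by (metis join_closed join_commute join_left_commute)

text \<open>The implicative law in terms of join: it is absorption, since (x' \<squnion> y)' is x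
  \<sqinter> y'.\<close>

lemma join_absorb:
  assumes "x \<in> carrier X" "y \<in> carrier X"
  shows "x \<squnion> (x\<^sup>\<star> \<squnion> y)\<^sup>\<star> = x"
  using implicative [OF assms] assms
  by (simp add: imp_eq_join imp_closed join_commute)

text \<open>The orthomodular law for x below x \<squnion> y, complemented so that only joins and
  complements occur.\<close>

lemma join_neg_join_eq:
  assumes "x \<in> carrier X" "y \<in> carrier X"
  shows "(x \<squnion> (x \<squnion> y)\<^sup>\<star>)\<^sup>\<star> \<squnion> (x \<squnion> y)\<^sup>\<star> = x\<^sup>\<star>"
proof -
  let ?p = "(x \<squnion> (x \<squnion> y)\<^sup>\<star>)\<^sup>\<star> \<squnion> (x \<squnion> y)\<^sup>\<star>"
  have "y\<^sup>\<star> \<leadsto> x = x \<squnion> y"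
    using assms by (simp add: imp_eq_join involutive join_commute)
  then have "?p\<^sup>\<star> = x"
    using orthomodular [of x "y\<^sup>\<star>"] assms by (simp add: Cap_eq_join)
  moreover have "(?p\<^sup>\<star>)\<^sup>\<star> = ?p"
    using assms by (simp add: involutive)
  ultimately show ?thesis
    by simp
qed

lemma commutes_sym:
  assumes a: "a \<in> carrier X" and b: "b \<in> carrier X"
    and ab: "a \<squnion> (a \<^bold>\<inter> b) = a"
  shows "b \<squnion> (b \<^bold>\<inter> a) = b"
proof -
  define p where "p = (a \<squnion> b\<^sup>\<star>)\<^sup>\<star> \<squnion> b\<^sup>\<star>"
  have p: "p \<in> carrier X"
    using a b by (simp add: p_def)
  have "a \<squnion> p\<^sup>\<star> = a"
    using ab a b by (simp add: Cap_eq_join p_def)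
  \<comment> \<open>Absorption reverses the order under complement: p' below a gives a' below
    p.\<close>
  then have "a\<^sup>\<star> \<squnion> p = p"
    using join_absorb [of p a] a p by (simp add: join_commute)
  moreover have below: "a\<^sup>\<star> \<squnion> (a \<squnion> b\<^sup>\<star>)\<^sup>\<star> = a\<^sup>\<star>"
    using join_absorb [of "a\<^sup>\<star>" "b\<^sup>\<star>"] a b by (simp add: involutive)
  \<comment> \<open>Joining a' to p leaves p unchanged, yet swallows its first joinand, which lies
    below a'.\<close>
  ultimately have p_eq: "p = a\<^sup>\<star> \<squnion> b\<^sup>\<star>"
    using a b unfolding p_def by (metis join_assoc join_closed neg_closed)
  have "(b\<^sup>\<star> \<squnion> (b\<^sup>\<star> \<squnion> a)\<^sup>\<star>)\<^sup>\<star> \<squnion> (b\<^sup>\<star> \<squnion> a)\<^sup>\<star> = b"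
    using join_neg_join_eq [of "b\<^sup>\<star>" a] a b by (simp add: involutive)
  \<comment> \<open>The first joinand just obtained is p', hence a \<sqinter> b.\<close>
  then have "b = (a\<^sup>\<star> \<squnion> b\<^sup>\<star>)\<^sup>\<star> \<squnion> (a \<squnion> b\<^sup>\<star>)\<^sup>\<star>"
    using p_eq a b by (simp add: p_def join_commute)
  then have "b \<squnion> a\<^sup>\<star> = (a\<^sup>\<star> \<squnion> b\<^sup>\<star>)\<^sup>\<star> \<squnion> a\<^sup>\<star>"
    using a b join_assoc [of "(a\<^sup>\<star> \<squnion> b\<^sup>\<star>)\<^sup>\<star>" "(a \<squnion> b\<^sup>\<star>)\<^sup>\<star>" "a\<^sup>\<star>"]
      join_commute [of "a\<^sup>\<star>" "(a \<squnion> b\<^sup>\<star>)\<^sup>\<star>"] below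
    by simp
  moreover have "(a\<^sup>\<star> \<squnion> b\<^sup>\<star>)\<^sup>\<star> \<squnion> a = a"
    using join_absorb [of a "b\<^sup>\<star>"] a b by (simp add: join_commute)
  \<comment> \<open>Orthomodularity for a \<sqinter> b below a: the inner join collapses to a, and b
    \<squnion> a' replaces (a \<sqinter> b) \<squnion> a'.\<close>
  ultimately have "(b \<squnion> a\<^sup>\<star>)\<^sup>\<star> \<squnion> a\<^sup>\<star> = a\<^sup>\<star> \<squnion> b\<^sup>\<star>"
    using join_neg_join_eq [of "(a\<^sup>\<star> \<squnion> b\<^sup>\<star>)\<^sup>\<star>" a] a b by (simp add: involutive)
  \<comment> \<open>The projection of b to a is thus a \<sqinter> b, which b absorbs.\<close>
  then show ?thesis
    using join_absorb [of b "a\<^sup>\<star>"] a b by (simp add: Cap_eq_join join_commute)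
qed

end

theorem proposition6p6:
  fixes X (structure)
  assumes "implicative_orthomodular_lattice X"
    and "x \<in> carrier X" and "y \<in> carrier X"
  shows "x \<leadsto> (x\<^sup>\<star> \<^bold>\<inter> y\<^sup>\<star>) = x\<^sup>\<star> \<longleftrightarrow> y \<leadsto> (y\<^sup>\<star> \<^bold>\<inter> x\<^sup>\<star>) = y\<^sup>\<star>"
proof -
  interpret implicative_orthomodular_lattice X by fact
  show ?thesis
    using commutes_sym [of "x\<^sup>\<star>" "y\<^sup>\<star>"] commutes_sym [of "y\<^sup>\<star>" "x\<^sup>\<star>"] assms(2,3)
    by (auto simp: imp_eq_join)
qed

end
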